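(* Let $n$ be a positive integer and let $X$ be an $S(2n)$-space. Then $|X|\leq 2^{sL_{\theta(n)}(X)\,\kappa_{\theta(n)}(X)}$.
   Context: All spaces are topological spaces and are assumed to be $T_1$. $\overline{A}$ and $cl\,A$ both denote the usual closure of $A$ in $X$. $\theta^k$-closure: for a positive integer $k$, a subset $M\subset X$ and a point $x\in X$, we have $x\notin cl_{\theta^k}M$ iff there exist open neighborhoods $U_1\subset U_2\subset\dots\subset U_k$ of $x$ such that $cl\,U_i\subset U_{i+1}$ for $i=1,\dots,k-1$ and $cl\,U_k\cap M=\emptyset$. So $cl_{\theta^k}M$ is the set of all points $x$ for which no such chain exists. $S(k)$-space: for a positive integer $k$, $X$ is an $S(k)$-space if any two different points $x,y\in X$ are $S(k)$-separated, i.e. $x\notin cl_{\theta^k}\{y\}$ (a symmetric relation for $k>0$). $n$-hull: an open set $U$ is an $n$-hull of a set $A\subseteq X$ if there are open sets $U_1,U_2,\dots,U_n=U$ such that $A\subseteq U_1$ and $cl\,U_i\subseteq U_{i+1}$ for $i=1,\dots,n-1$. A closed $n$-hull of $A$ is the closure of an $n$-hull of $A$. A (closed) $n$-hull of a point $x$ is a (closed) $n$-hull of $\{x\}$. $sL_{\theta(n)}(X)$ is the smallest cardinal $\kappa$ such that if $A\subset X$, $\mathcal{U}$ is a collection of open subsets of $X$ and $cl_{\theta^n}(A)\subset\bigcup\mathcal{U}$, then there is $\mathcal{V}\subset\mathcal{U}$ with $|\mathcal{V}|\leq\kappa$ and $A\subset\overline{\bigcup\mathcal{V}}$. $\kappa_{\theta(n)}(X)$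 is the smallest cardinal $\kappa$ such that for each point $x\in X$ there is a collection $\mathcal{V}_x$ of closed $n$-hulls of $x$ such that $|\mathcal{V}_x|\leq\kappa$ and every closed $n$-hull $W$ of $x$ contains a member of $\mathcal{V}_x$. *)

theory Defs
  imports "HOL-Analysis.Analysis"
begin

unbundle cardinal_syntax

text \<open>The chains of open sets are indexed by \<open>{1..k}\<close>; the notions below are only meant for positive
  \<open>k\<close> and \<open>n\<close>.\<close>

definition theta_closure :: "'a topology \<Rightarrow> nat \<Rightarrow> 'a set \<Rightarrow> 'a set" where
  "theta_closure X k M =
     {x \<in> topspace X.
        \<not> (\<exists>U :: nat \<Rightarrow> 'a set.
              (\<forall>i\<in>{1..k}. openin X (U i) \<and> x \<in> U i) \<and>
              (\<forall>i\<in>{1..<k}. U i \<subseteq> U (Suc i) \<and> X closure_of U i \<subseteq> U (Suc i)) \<and>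
              X closure_of U k \<inter> M = {})}"

definition S_space :: "'a topology \<Rightarrow> nat \<Rightarrow> bool" where
  "S_space X k \<longleftrightarrow>
     (\<forall>x\<in>topspace X. \<forall>y\<in>topspace X. x \<noteq> y \<longrightarrow> x \<notin> theta_closure X k {y})"

definition is_hull :: "'a topology \<Rightarrow> nat \<Rightarrow> 'a set \<Rightarrow> 'a set \<Rightarrow> bool" where
  "is_hull X n A H \<longleftrightarrow>
     (\<exists>U :: nat \<Rightarrow> 'a set.
        (\<forall>i\<in>{1..n}. openin X (U i)) \<and> U n = H \<and> A \<subseteq> U 1 \<and>
        (\<forall>i\<in>{1..<n}. X closure_of U i \<subseteq> U (Suc i)))"

definition is_closed_hull :: "'a topology \<Rightarrow> nat \<Rightarrow> 'a set \<Rightarrow> 'a set \<Rightarrow> bool" where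
  "is_closed_hull X n A W \<longleftrightarrow> (\<exists>H. is_hull X n A H \<and> W = X closure_of H)"

definition sL_theta_bound :: "'a topology \<Rightarrow> nat \<Rightarrow> 'b rel \<Rightarrow> bool" where
  "sL_theta_bound X n \<kappa> \<longleftrightarrow>
     (\<forall>A \<U>. A \<subseteq> topspace X \<and> (\<forall>U\<in>\<U>. openin X U) \<and> theta_closure X n A \<subseteq> \<Union>\<U> \<longrightarrow>
        (\<exists>\<V>\<subseteq>\<U>. |\<V>| \<le>o \<kappa> \<and> A \<subseteq> X closure_of \<Union>\<V>))"

definition kappa_theta_bound :: "'a topology \<Rightarrow> nat \<Rightarrow> 'b rel \<Rightarrow> bool" where
  "kappa_theta_bound X n \<kappa> \<longleftrightarrow>
     (\<forall>x\<in>topspace X. \<exists>\<V>. (\<forall>V\<in>\<V>. is_closed_hull X n {x} V) \<and> |\<V>| \<le>o \<kappa> \<and>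
        (\<forall>W. is_closed_hull X n {x} W \<longrightarrow> (\<exists>V\<in>\<V>. V \<subseteq> W)))"

text \<open>Cardinals are canonical well-orders, compared by \<open>\<le>o\<close>; a least one is unique only up to
  \<open>=o\<close>, hence the choice. Finite cardinals, including zero, are allowed.\<close>

definition least_cardinal :: "('b rel \<Rightarrow> bool) \<Rightarrow> 'b rel" where
  "least_cardinal P =
     (SOME \<kappa>. Card_order \<kappa> \<and> P \<kappa> \<and> (\<forall>\<kappa>'. Card_order \<kappa>' \<and> P \<kappa>' \<longrightarrow> \<kappa> \<le>o \<kappa>'))"

text \<open>All families involved consist of subsets of the space, so a least cardinal exists on the type
  \<open>'a set\<close>; that it is also least among cardinals on arbitrary types is proved below.\<close>

definition sL_theta :: "'a topology \<Rightarrow> nat \<Rightarrow> 'a set rel" where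
  "sL_theta X n = least_cardinal (sL_theta_bound X n)"

definition kappa_theta :: "'a topology \<Rightarrow> nat \<Rightarrow> 'a set rel" where
  "kappa_theta X n = least_cardinal (kappa_theta_bound X n)"

lemma least_cardinal:
  assumes "Card_order \<kappa>" "P \<kappa>"
  shows "Card_order (least_cardinal P)" "P (least_cardinal P)" "least_cardinal P \<le>o \<kappa>"
proof -
  have "\<exists>r\<in>{r. Card_order r \<and> P r}. \<forall>r'\<in>{r. Card_order r \<and> P r}. r \<le>o r'"
    using assms by (intro exists_minim_Card_order) auto
  then have "\<exists>r. Card_order r \<and> P r \<and> (\<forall>r'. Card_order r' \<and> P r' \<longrightarrow> r \<le>o r')"
    by blast
  from someI_ex[OF this, folded least_cardinal_def] assms
  show "Card_order (least_cardinal P)" "P (least_cardinal P)" "least_cardinal P \<le>o \<kappa>"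
    by blast+
qed

lemma least_cardinal_across_types:
  fixes P :: "'b rel \<Rightarrow> bool" and \<kappa> :: "'c rel"
  assumes top: "P |UNIV|"
    and transfer: "\<And>\<kappa>'. \<kappa> =o \<kappa>' \<Longrightarrow> P \<kappa>'"
    and card: "Card_order \<kappa>"
  shows "least_cardinal P \<le>o \<kappa>"
proof (cases "\<kappa> \<le>o |UNIV :: 'b set|")
  case True
  then have "|Field \<kappa>| \<le>o |UNIV :: 'b set|"
    using ordIso_ordLeq_trans[OF card_of_Field_ordIso[OF card]] by blast
  then obtain B :: "'b set" where "|Field \<kappa>| =o |B|"
    using internalize_card_of_ordLeq2[of "Field \<kappa>" "UNIV :: 'b set"] by blast
  from ordIso_transitive[OF ordIso_symmetric[OF card_of_Field_ordIso[OF card]] this]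
  have B: "\<kappa> =o |B|" .
  show ?thesis
    by (rule ordLeq_ordIso_trans[OF least_cardinal(3)[where P = P, OF card_of_Card_order transfer[OF B]]
          ordIso_symmetric[OF B]])
next
  case False
  then have "|UNIV :: 'b set| \<le>o \<kappa>"
    using card card_of_Well_order[of "UNIV :: 'b set"] ordLeq_total[of \<kappa> "|UNIV :: 'b set|"]
    unfolding card_order_on_def by blast
  then show ?thesis
    by (rule ordLeq_transitive[OF least_cardinal(3)[where P = P, OF card_of_Card_order top]])
qed

lemma sL_theta_bound_mono:
  "sL_theta_bound X n \<kappa> \<Longrightarrow> \<kappa> \<le>o \<kappa>' \<Longrightarrow> sL_theta_bound X n \<kappa>'"
  unfolding sL_theta_bound_def by (meson ordLeq_transitive)

lemma kappa_theta_bound_mono: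
  "kappa_theta_bound X n \<kappa> \<Longrightarrow> \<kappa> \<le>o \<kappa>' \<Longrightarrow> kappa_theta_bound X n \<kappa>'"
  unfolding kappa_theta_bound_def by (meson ordLeq_transitive)

lemma sL_theta_bound_UNIV:
  fixes X :: "'a topology"
  assumes "n \<ge> 1"
  shows "sL_theta_bound X n |UNIV :: 'a set set|"
proof -
  have "A \<subseteq> X closure_of \<Union>\<U>"
    if A: "A \<subseteq> topspace X" "\<forall>U\<in>\<U>. openin X U" "theta_closure X n A \<subseteq> \<Union>\<U>" for A \<U>
  proof -
    have "x \<in> theta_closure X n A" if "x \<in> A" for x
    proof -
      have "x \<in> X closure_of U n" if "\<forall>i\<in>{1..n}. openin X (U i) \<and> x \<in> U i" for U
        using that assms closure_of_subset[of "U n" X] openin_subset[of X "U n"] by auto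
      then show ?thesis
        using \<open>x \<in> A\<close> A(1) unfolding theta_closure_def by blast
    qed
    then have "A \<subseteq> \<Union>\<U>" using A(3) by blast
    moreover have "\<Union>\<U> \<subseteq> topspace X" using A(2) openin_subset by blast
    ultimately show ?thesis using closure_of_subset by blast
  qed
  then show ?thesis
    unfolding sL_theta_bound_def using card_of_mono1[OF subset_UNIV] by blast
qed

lemma kappa_theta_bound_UNIV:
  fixes X :: "'a topology"
  shows "kappa_theta_bound X n |UNIV :: 'a set set|"
  unfolding kappa_theta_bound_def
proof
  fix x
  show "\<exists>\<V>. (\<forall>V\<in>\<V>. is_closed_hull X n {x} V) \<and> |\<V>| \<le>o |UNIV :: 'a set set| \<and>
        (\<forall>W. is_closed_hull X n {x} W \<longrightarrow> (\<exists>V\<in>\<V>. V \<subseteq> W))"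
    by (rule exI[of _ "Collect (is_closed_hull X n {x})"]) (auto intro: card_of_mono1)
qed

lemma sL_theta:
  assumes "n \<ge> 1"
  shows "Card_order (sL_theta X n)" and "sL_theta_bound X n (sL_theta X n)"
  using least_cardinal(1,2)[where P = "sL_theta_bound X n", OF card_of_Card_order sL_theta_bound_UNIV[OF assms]]
  unfolding sL_theta_def by blast+

lemma sL_theta_least:
  fixes X :: "'a topology" and \<kappa> :: "'c rel"
  assumes "n \<ge> 1" and "Card_order \<kappa>" and "sL_theta_bound X n \<kappa>"
  shows "sL_theta X n \<le>o \<kappa>"
  unfolding sL_theta_def
proof (rule least_cardinal_across_types[where P = "sL_theta_bound X n", OF sL_theta_bound_UNIV[OF assms(1)] _ assms(2)])
  show "sL_theta_bound X n \<kappa>'" if "\<kappa> =o \<kappa>'" for \<kappa>' :: "'a set rel"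
    by (rule sL_theta_bound_mono[OF assms(3) ordIso_imp_ordLeq[OF that]])
qed

lemma kappa_theta:
  shows "Card_order (kappa_theta X n)" and "kappa_theta_bound X n (kappa_theta X n)"
  using least_cardinal(1,2)[where P = "kappa_theta_bound X n", OF card_of_Card_order kappa_theta_bound_UNIV]
  unfolding kappa_theta_def by blast+

lemma kappa_theta_least:
  fixes X :: "'a topology" and \<kappa> :: "'c rel"
  assumes "Card_order \<kappa>" and "kappa_theta_bound X n \<kappa>"
  shows "kappa_theta X n \<le>o \<kappa>"
  unfolding kappa_theta_def
proof (rule least_cardinal_across_types[where P = "kappa_theta_bound X n", OF kappa_theta_bound_UNIV _ assms(1)])
  show "kappa_theta_bound X n \<kappa>'" if "\<kappa> =o \<kappa>'" for \<kappa>' :: "'a set rel"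
    by (rule kappa_theta_bound_mono[OF assms(2) ordIso_imp_ordLeq[OF that]])
qed

end

theory Submission
  imports Defs
begin

text \<open>
  If the product \<open>\<kappa>\<close> of the two invariants is finite and \<open>X\<close> is nonempty, then every point has a
  smallest closed \<open>n\<close>-hull. Distinct points of an \<open>S(2n)\<close>-space have disjoint closed \<open>n\<close>-hulls
  (\<open>S_space_disjoint_closed_hulls\<close>), so \<open>X\<close> is discrete, and covering \<open>X\<close> by singletons shows that
  \<open>|X|\<close> is at most the covering invariant.

  Let \<open>\<kappa>\<close> be infinite. For every point \<open>x\<close> fix at most \<open>\<kappa>\<close> closed \<open>n\<close>-hulls that are cofinal among
  all its closed \<open>n\<close>-hulls. When \<open>x\<close> belongs to the \<open>\<theta>\<^sup>n\<close>-closure of \<open>A\<close>, it is determined by the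
  traces on \<open>A\<close> of these hulls. Hence the \<open>\<theta>\<^sup>n\<close>-closure of a set of size at most \<open>\<kappa>\<close> has size at most
  \<open>2\<^sup>\<kappa>\<close> (\<open>card_theta_closure\<close>); moreover, each point of the \<open>\<theta>\<^sup>n\<close>-closure of \<open>A\<close> lies in that of a
  subset of \<open>A\<close> of size at most \<open>\<kappa>\<close> (\<open>theta_closure_small_subset\<close>). Closing off in \<open>\<kappa>\<^sup>+\<close> steps
  (\<open>ex_small_closed_set\<close>) yields a set \<open>F\<close> of size at most \<open>2\<^sup>\<kappa>\<close> that is equal to its
  \<open>\<theta>\<^sup>n\<close>-closure and that meets the complement of the closure of \<open>\<Union>\<G>\<close> whenever \<open>\<G>\<close> consists of
  chosen hulls of at most \<open>\<kappa>\<close> points of \<open>F\<close> and \<open>\<Union>\<G>\<close> is not dense.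

  Finally \<open>F\<close> is the whole space. A point \<open>p\<close> outside \<open>F\<close> has a closed \<open>n\<close>-hull disjoint from \<open>F\<close>.
  Taking complements reverses the chain of open sets witnessing this, so all points of \<open>F\<close> have
  chosen hulls that avoid one common neighbourhood of \<open>p\<close>. At most \<open>\<kappa>\<close> of them have a union whose
  closure contains \<open>F\<close>, whereas that closure does not contain \<open>p\<close>; this contradicts the choice
  of \<open>F\<close>.
\<close>

section \<open>Closing off in the power of an infinite cardinal\<close>

lemma Cinfinite_ctwo_cexp: "Cinfinite \<kappa> \<Longrightarrow> Cinfinite (ctwo ^c \<kappa>)"
  by (intro Cinfinite_cexp ordLeq_refl Card_order_ctwo)

lemma ordLeq_ctwo_cexp: "Card_order \<kappa> \<Longrightarrow> \<kappa> \<le>o ctwo ^c \<kappa>"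
  by (rule ordLess_imp_ordLeq[OF ordLess_ctwo_cexp])

lemma card_small_subsets:
  fixes \<kappa> :: "'k rel" and S :: "'a set"
  assumes \<kappa>: "Cinfinite \<kappa>" and S: "|S| \<le>o ctwo ^c \<kappa>"
  shows "|{B. B \<subseteq> S \<and> |B| \<le>o \<kappa>}| \<le>o ctwo ^c \<kappa>"
proof -
  have "|Func (Field \<kappa>) S| \<le>o ctwo ^c \<kappa>"
  proof -
    have "|Func (Field \<kappa>) S| = |S| ^c \<kappa>"
      by (simp add: cexp_def Field_card_of)
    moreover have "|S| ^c \<kappa> \<le>o (ctwo ^c \<kappa>) ^c \<kappa>"
      using S \<kappa> by (intro cexp_mono1) auto
    moreover have "(ctwo ^c \<kappa>) ^c \<kappa> =o ctwo ^c \<kappa>"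
      using \<kappa> by (intro cexp_cprod_ordLeq Card_order_ctwo Cinfinite_Cnotzero ordLeq_refl) auto
    ultimately show ?thesis
      using ordLeq_ordIso_trans by metis
  qed
  moreover have "{B. B \<subseteq> S \<and> |B| \<le>o \<kappa>} - {{}} \<subseteq> (\<lambda>f. f ` Field \<kappa>) ` Func (Field \<kappa>) S"
  proof
    fix B assume "B \<in> {B. B \<subseteq> S \<and> |B| \<le>o \<kappa>} - {{}}"
    then have B: "B \<subseteq> S" "|B| \<le>o \<kappa>" "B \<noteq> {}" by auto
    have "|B| \<le>o |Field \<kappa>|"
      using B(2) \<kappa> ordLeq_ordIso_trans ordIso_symmetric card_of_Field_ordIso by blast
    then obtain g where g: "g ` Field \<kappa> = B"
      unfolding card_of_ordLeq2[OF B(3), symmetric] by blast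
    let ?f = "\<lambda>i. if i \<in> Field \<kappa> then g i else undefined"
    have "?f \<in> Func (Field \<kappa>) S"
      using g B(1) by (auto simp: Func_def)
    moreover have "?f ` Field \<kappa> = B"
      using g by auto
    ultimately show "B \<in> (\<lambda>f. f ` Field \<kappa>) ` Func (Field \<kappa>) S"
      by blast
  qed
  ultimately have "|{B. B \<subseteq> S \<and> |B| \<le>o \<kappa>} - {{}}| \<le>o ctwo ^c \<kappa>"
    using ordLeq_transitive[OF surj_imp_ordLeq] by blast
  moreover have "|{{} :: 'a set}| \<le>o ctwo ^c \<kappa>"
  proof (rule ordLess_imp_ordLeq[OF Cfinite_ordLess_Cinfinite[OF _ Cinfinite_ctwo_cexp[OF \<kappa>]]])
    show "Cfinite |{{} :: 'a set}|"
      by (rule conjI[OF _ card_of_Card_order]) (simp add: cfinite_def Field_card_of)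
  qed
  ultimately have "|({B. B \<subseteq> S \<and> |B| \<le>o \<kappa>} - {{}}) \<union> {{}}| \<le>o ctwo ^c \<kappa>"
    by (intro Un_Cinfinite_bound Cinfinite_ctwo_cexp \<kappa>)
  then show ?thesis
    by (rule ordLeq_transitive[OF card_of_mono1, rotated]) auto
qed

lemma card_Pow_le_ctwo_cexp:
  assumes "Cinfinite \<kappa>" and "|A| \<le>o \<kappa>"
  shows "|Pow A| \<le>o ctwo ^c \<kappa>"
proof -
  have "|A| \<le>o ctwo ^c \<kappa>"
    using assms ordLeq_transitive ordLeq_ctwo_cexp by blast
  note card_small_subsets[OF assms(1) this]
  moreover have "Pow A \<subseteq> {B. B \<subseteq> A \<and> |B| \<le>o \<kappa>}"
    using assms(2) ordLeq_transitive card_of_mono1 by blast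
  ultimately show ?thesis
    using ordLeq_transitive card_of_mono1 by blast
qed

text \<open>Only the values of \<open>\<Phi>\<close> at sets of size at most \<open>\<kappa>\<close> matter. The set \<open>F\<close> is the union of an
  increasing chain of length \<open>\<kappa>\<^sup>+\<close>; since \<open>\<kappa>\<^sup>+\<close> is regular, each subset of \<open>F\<close> of size at most \<open>\<kappa>\<close>
  appears at some stage.\<close>

lemma ex_small_closed_set:
  fixes \<kappa> :: "'k rel" and \<Phi> :: "'a set \<Rightarrow> 'a set"
  assumes \<kappa>: "Cinfinite \<kappa>" and \<Phi>: "\<And>B. |B| \<le>o \<kappa> \<Longrightarrow> |\<Phi> B| \<le>o ctwo ^c \<kappa>"
  obtains F where "|F| \<le>o ctwo ^c \<kappa>" and "F \<subseteq> \<Union>(range \<Phi>)"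
    and "\<And>B. B \<subseteq> F \<Longrightarrow> |B| \<le>o \<kappa> \<Longrightarrow> \<Phi> B \<subseteq> F"
proof -
  define r where "r = cardSuc \<kappa>"
  have r: "Cinfinite r"
    unfolding r_def by (rule Cinfinite_cardSuc[OF \<kappa>])
  then interpret r: wo_rel r
    by (simp add: wo_rel_def card_order_on_def)
  define H :: "('k set \<Rightarrow> 'a set) \<Rightarrow> 'k set \<Rightarrow> 'a set" where
    "H G i = (\<Union>j\<in>underS r i. G j) \<union> (\<Union>B\<in>{B. B \<subseteq> (\<Union>j\<in>underS r i. G j) \<and> |B| \<le>o \<kappa>}. \<Phi> B)" for G i
  define G where "G = r.worec H"
  have "r.adm_wo H"
    unfolding r.adm_wo_def H_def by simp
  then have "G = H G"
    unfolding G_def by (rule r.worec_fixpoint)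
  then have G: "G i = (\<Union>j\<in>underS r i. G j) \<union>
      (\<Union>B\<in>{B. B \<subseteq> (\<Union>j\<in>underS r i. G j) \<and> |B| \<le>o \<kappa>}. \<Phi> B)" for i
    unfolding H_def by metis
  have Field_r: "|Field r| \<le>o ctwo ^c \<kappa>"
  proof -
    have "r \<le>o ctwo ^c \<kappa>"
      unfolding r_def using \<kappa> by (intro cardSuc_least Card_order_cexp ordLess_ctwo_cexp) auto
    then show ?thesis
      using r ordIso_ordLeq_trans card_of_Field_ordIso by blast
  qed
  have G_card: "|G i| \<le>o ctwo ^c \<kappa>" for i
  proof (induction i rule: r.well_order_induct)
    case (1 i)
    have "|underS r i| \<le>o ctwo ^c \<kappa>"
      by (rule ordLeq_transitive[OF card_of_mono1 Field_r]) (auto simp: underS_def Field_def)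
    then have S: "|\<Union>j\<in>underS r i. G j| \<le>o ctwo ^c \<kappa>"
      using 1 by (intro UNION_Cinfinite_bound Cinfinite_ctwo_cexp \<kappa>) (auto simp: underS_def)
    have "|\<Union>B\<in>{B. B \<subseteq> (\<Union>j\<in>underS r i. G j) \<and> |B| \<le>o \<kappa>}. \<Phi> B| \<le>o ctwo ^c \<kappa>"
      using \<Phi> by (intro UNION_Cinfinite_bound[OF card_small_subsets[OF \<kappa> S]] Cinfinite_ctwo_cexp \<kappa>) auto
    then show ?case
      unfolding G[of i] by (intro Un_Cinfinite_bound[OF S] Cinfinite_ctwo_cexp \<kappa>)
  qed
  have G_range: "G i \<subseteq> \<Union>(range \<Phi>)" for i
  proof (induction i rule: r.well_order_induct)
    case (1 i)
    then show ?case
      unfolding G[of i] by (force simp: underS_def)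
  qed
  have G_below: "G i \<subseteq> G j" "\<And>B. B \<subseteq> G i \<Longrightarrow> |B| \<le>o \<kappa> \<Longrightarrow> \<Phi> B \<subseteq> G j"
    if "i \<in> underS r j" for i j
    using that G[of j] by blast+
  have chain: "relChain r G"
    unfolding relChain_def
  proof (intro allI impI)
    fix i j assume "(i, j) \<in> r"
    then have "i = j \<or> i \<in> underS r j"
      by (auto simp: underS_def)
    then show "G i \<subseteq> G j"
      using G_below(1)[of i j] by blast
  qed
  define F where "F = (\<Union>i\<in>Field r. G i)"
  show ?thesis
  proof
    show "|F| \<le>o ctwo ^c \<kappa>"
      unfolding F_def using Field_r G_card
      by (intro UNION_Cinfinite_bound Cinfinite_ctwo_cexp \<kappa>) auto
    show "F \<subseteq> \<Union>(range \<Phi>)"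
      unfolding F_def using G_range by blast
    fix B assume B: "B \<subseteq> F" "|B| \<le>o \<kappa>"
    obtain i where i: "i \<in> Field r" "B \<subseteq> G i"
      using cardSuc_UNION_Cinfinite[OF \<kappa> chain[unfolded r_def] B(1)[unfolded F_def r_def] B(2)]
      unfolding r_def by blast
    obtain j where "j \<in> Field r" "i \<in> underS r j"
      using infinite_Card_order_limit[of r i] r i(1) by (auto simp: cinfinite_def underS_def)
    then show "\<Phi> B \<subseteq> F"
      using G_below(2)[OF _ i(2) B(2)] unfolding F_def by blast
  qed
qed

section \<open>Hulls and iterated closures\<close>

lemma is_hullE:
  assumes "is_hull X n A H" and "n \<ge> 1"
  obtains "openin X H" and "A \<subseteq> H"
proof -
  obtain U :: "nat \<Rightarrow> 'a set" where U: "\<forall>i\<in>{1..n}. openin X (U i)" "U n = H" "A \<subseteq> U 1"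
      "\<forall>i\<in>{1..<n}. X closure_of U i \<subseteq> U (Suc i)"
    using assms(1) unfolding is_hull_def by blast
  have "i \<le> n \<longrightarrow> A \<subseteq> U i" if "1 \<le> i" for i
    using that
  proof (induction i rule: dec_induct)
    case (step i)
    then show ?case
      using U(1,4) closure_of_subset[of "U i" X] openin_subset[of X "U i"] by fastforce
  qed (use U(3) in auto)
  then show ?thesis
    using that U(1,2) assms(2) by auto
qed

lemma is_closed_hull_subset:
  assumes "is_closed_hull X n A W" and "n \<ge> 1"
  shows "A \<subseteq> W"
proof -
  obtain H where H: "is_hull X n A H" "W = X closure_of H"
    using assms(1) unfolding is_closed_hull_def by blast
  have "openin X H" "A \<subseteq> H"
    using is_hullE[OF H(1) assms(2)] by blast+
  then show ?thesis
    unfolding H(2) using closure_of_subset[OF openin_subset] by blast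
qed

lemma is_closed_hull_topspace:
  assumes "A \<subseteq> topspace X"
  shows "is_closed_hull X n A (topspace X)"
  unfolding is_closed_hull_def is_hull_def
  using assms by (intro exI[of _ "topspace X"] conjI exI[of _ "\<lambda>_. topspace X"])
    (auto simp: closure_of_topspace)

lemma is_closed_hull_Int:
  assumes "is_closed_hull X n A V" and "is_closed_hull X n A W"
  obtains W' where "is_closed_hull X n A W'" and "W' \<subseteq> V \<inter> W"
proof -
  obtain S T :: "nat \<Rightarrow> 'a set" where S: "\<forall>i\<in>{1..n}. openin X (S i)" "V = X closure_of S n" "A \<subseteq> S 1"
      "\<forall>i\<in>{1..<n}. X closure_of S i \<subseteq> S (Suc i)"
    and T: "\<forall>i\<in>{1..n}. openin X (T i)" "W = X closure_of T n" "A \<subseteq> T 1"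
      "\<forall>i\<in>{1..<n}. X closure_of T i \<subseteq> T (Suc i)"
    using assms unfolding is_closed_hull_def is_hull_def by blast
  have cl: "X closure_of (S i \<inter> T i) \<subseteq> X closure_of S i \<inter> X closure_of T i" for i
    by (simp add: closure_of_mono)
  have "is_hull X n A (S n \<inter> T n)"
    unfolding is_hull_def
  proof (intro exI[of _ "\<lambda>i. S i \<inter> T i"] conjI ballI)
    fix i assume "i \<in> {1..<n}"
    then show "X closure_of (S i \<inter> T i) \<subseteq> S (Suc i) \<inter> T (Suc i)"
      using S(4) T(4) cl[of i] by blast
  qed (use S T in auto)
  then show ?thesis
    using that cl[of n] S(2) T(2) unfolding is_closed_hull_def by blast
qed

lemma is_closed_hull_Inter:
  assumes "finite \<V>" and "\<And>V. V \<in> \<V> \<Longrightarrow> is_closed_hull X n A V" and "A \<subseteq> topspace X"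
  shows "\<exists>W. is_closed_hull X n A W \<and> W \<subseteq> \<Inter>\<V>"
  using assms(1,2)
proof (induction \<V>)
  case empty
  then show ?case
    using is_closed_hull_topspace[OF assms(3)] by auto
next
  case (insert V \<V>)
  then obtain W where W: "is_closed_hull X n A W" "W \<subseteq> \<Inter>\<V>" by auto
  obtain W' where "is_closed_hull X n A W'" "W' \<subseteq> V \<inter> W"
    using is_closed_hull_Int[of X n A V W] insert.prems W(1) by auto
  then show ?case
    using W(2) by auto
qed

text \<open>Complementation reverses a chain \<open>U\<^sub>1, \<dots>, U\<^sub>n\<close> into the chain of the complements of
  \<open>cl U\<^sub>n, \<dots>, cl U\<^sub>1\<close>; the set \<open>G\<close> below is \<open>U\<^sub>1\<close>.\<close>

lemma is_hull_complement:
  assumes "is_hull X n A H" and "n \<ge> 1"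
  obtains G where "openin X G" and "A \<subseteq> G"
    and "is_hull X n (topspace X - X closure_of H) (topspace X - X closure_of G)"
proof -
  obtain U :: "nat \<Rightarrow> 'a set" where U: "\<forall>i\<in>{1..n}. openin X (U i)" "U n = H" "A \<subseteq> U 1"
      "\<forall>i\<in>{1..<n}. X closure_of U i \<subseteq> U (Suc i)"
    using assms(1) unfolding is_hull_def by blast
  let ?V = "\<lambda>i. topspace X - X closure_of U (Suc n - i)"
  have "X closure_of ?V i \<subseteq> ?V (Suc i)" if i: "i \<in> {1..<n}" for i
  proof -
    have op: "openin X (U (Suc n - i))"
      using i by (intro U(1)[rule_format]) auto
    have "X closure_of ?V i \<subseteq> topspace X - U (Suc n - i)"
    proof (rule closure_of_minimal)
      show "?V i \<subseteq> topspace X - U (Suc n - i)"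
        using closure_of_subset[OF openin_subset[OF op]] by blast
      show "closedin X (topspace X - U (Suc n - i))"
        using op by (intro closedin_diff) auto
    qed
    moreover have "n - i \<in> {1..<n}" "Suc n - i = Suc (n - i)"
      using i by auto
    then have "X closure_of U (n - i) \<subseteq> U (Suc n - i)"
      using U(4) by metis
    ultimately show ?thesis by auto
  qed
  then have "is_hull X n (topspace X - X closure_of H) (topspace X - X closure_of U 1)"
    unfolding is_hull_def using U(2) by (intro exI[of _ ?V]) auto
  then show ?thesis
    using that[of "U 1"] U(1,3) assms(2) by auto
qed

lemma closure_of_exterior_disjoint:
  assumes "openin X G"
  shows "X closure_of (topspace X - X closure_of G) \<inter> G = {}"
proof -
  have "(topspace X - X closure_of G) \<inter> G = {}"
    using closure_of_subset[of G X] openin_subset[OF assms] by auto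
  then show ?thesis
    using openin_Int_closure_of_eq_empty[OF assms] by (simp add: Int_commute)
qed

lemma theta_closure_iff_closed_hulls:
  assumes "n \<ge> 1"
  shows "x \<in> theta_closure X n M \<longleftrightarrow>
    x \<in> topspace X \<and> (\<forall>W. is_closed_hull X n {x} W \<longrightarrow> W \<inter> M \<noteq> {})"
proof -
  let ?chain = "\<lambda>U :: nat \<Rightarrow> 'a set. (\<forall>i\<in>{1..n}. openin X (U i) \<and> x \<in> U i) \<and>
    (\<forall>i\<in>{1..<n}. U i \<subseteq> U (Suc i) \<and> X closure_of U i \<subseteq> U (Suc i))"
  let ?hull = "\<lambda>U :: nat \<Rightarrow> 'a set. (\<forall>i\<in>{1..n}. openin X (U i)) \<and> {x} \<subseteq> U 1 \<and>
    (\<forall>i\<in>{1..<n}. X closure_of U i \<subseteq> U (Suc i))"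
  have "?chain U = ?hull U" for U
  proof
    assume U: "?hull U"
    have "x \<in> U i" if "i \<in> {1..n}" for i
    proof -
      have "is_hull X i {x} (U i)"
        unfolding is_hull_def using U that by (intro exI[of _ U]) auto
      then show ?thesis
        using is_hullE[of X i "{x}" "U i"] that by auto
    qed
    moreover have "U i \<subseteq> U (Suc i)" if "i \<in> {1..<n}" for i
      using U that closure_of_subset[of "U i" X] openin_subset[of X "U i"] by fastforce
    ultimately show "?chain U"
      using U by auto
  qed (use assms in auto)
  then have "x \<in> theta_closure X n M \<longleftrightarrow>
      x \<in> topspace X \<and> \<not> (\<exists>U. ?hull U \<and> X closure_of U n \<inter> M = {})"
    unfolding theta_closure_def by (simp only: mem_Collect_eq conj_assoc[symmetric])
  also have "\<dots> \<longleftrightarrow> x \<in> topspace X \<and> (\<forall>W. is_closed_hull X n {x} W \<longrightarrow> W \<inter> M \<noteq> {})"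
    unfolding is_closed_hull_def is_hull_def by blast
  finally show ?thesis .
qed

lemma theta_closure_subset_topspace: "theta_closure X n A \<subseteq> topspace X"
  unfolding theta_closure_def by blast

text \<open>The first half of a chain of length \<open>2n\<close> around \<open>x\<close> gives the hull of \<open>x\<close>; the complements of the
  second half give the hull of \<open>y\<close>.\<close>

lemma S_space_disjoint_closed_hulls:
  assumes "S_space X (2 * n)" and "n \<ge> 1" and "x \<in> topspace X" "y \<in> topspace X" "x \<noteq> y"
  obtains V W where "is_closed_hull X n {x} V" and "is_closed_hull X n {y} W" and "V \<inter> W = {}"
proof -
  have "1 \<le> 2 * n"
    using assms(2) by simp
  have "x \<notin> theta_closure X (2 * n) {y}"
    using assms unfolding S_space_def by blast
  then obtain U :: "nat \<Rightarrow> 'a set" where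
    U: "\<forall>i\<in>{1..2 * n}. openin X (U i)" "x \<in> U 1"
      "\<forall>i\<in>{1..<2 * n}. X closure_of U i \<subseteq> U (Suc i)" "y \<notin> X closure_of U (2 * n)"
    using assms(3) unfolding theta_closure_iff_closed_hulls[OF \<open>1 \<le> 2 * n\<close>]
      is_closed_hull_def is_hull_def by blast
  have "is_hull X n {x} (U n)"
    unfolding is_hull_def using U by (intro exI[of _ U]) auto
  moreover have "is_hull X n (X closure_of U n) (U (2 * n))"
    unfolding is_hull_def using U assms(2)
    by (intro exI[of _ "\<lambda>i. U (n + i)"]) (auto simp: mult_2)
  then obtain G where G: "openin X G" "X closure_of U n \<subseteq> G"
      "is_hull X n (topspace X - X closure_of U (2 * n)) (topspace X - X closure_of G)"
    using is_hull_complement assms(2) by blast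
  have "is_hull X n {y} (topspace X - X closure_of G)"
    using G(3) U(4) assms(4) unfolding is_hull_def by blast
  moreover have "X closure_of U n \<inter> X closure_of (topspace X - X closure_of G) = {}"
    using closure_of_exterior_disjoint[OF G(1)] G(2) by blast
  ultimately show ?thesis
    using that unfolding is_closed_hull_def by blast
qed

section \<open>Cardinality of iterated closures\<close>

lemma theta_closure_small_subset:
  assumes "kappa_theta_bound X n \<kappa>" and "n \<ge> 1" and "x \<in> theta_closure X n A"
  obtains B where "B \<subseteq> A" and "|B| \<le>o \<kappa>" and "x \<in> theta_closure X n B"
proof -
  have x: "x \<in> topspace X" "\<And>W. is_closed_hull X n {x} W \<Longrightarrow> W \<inter> A \<noteq> {}"
    using assms(3) unfolding theta_closure_iff_closed_hulls[OF assms(2)] by auto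
  obtain \<V> where \<V>: "\<forall>V\<in>\<V>. is_closed_hull X n {x} V" "|\<V>| \<le>o \<kappa>"
      "\<And>W. is_closed_hull X n {x} W \<Longrightarrow> \<exists>V\<in>\<V>. V \<subseteq> W"
    using assms(1) x(1) unfolding kappa_theta_bound_def by metis
  have "\<forall>V\<in>\<V>. \<exists>a. a \<in> V \<inter> A"
    using \<V>(1) x(2) by blast
  from bchoice[OF this] obtain a where a: "\<And>V. V \<in> \<V> \<Longrightarrow> a V \<in> V \<inter> A"
    by blast
  show ?thesis
  proof
    show "a ` \<V> \<subseteq> A"
      using a by blast
    show "|a ` \<V>| \<le>o \<kappa>"
      using \<V>(2) card_of_image ordLeq_transitive by blast
    show "x \<in> theta_closure X n (a ` \<V>)"
      unfolding theta_closure_iff_closed_hulls[OF assms(2)]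
    proof (intro conjI allI impI x(1))
      fix W assume "is_closed_hull X n {x} W"
      then obtain V where "V \<in> \<V>" "V \<subseteq> W"
        using \<V>(3) by blast
      then show "W \<inter> a ` \<V> \<noteq> {}"
        using a[of V] by blast
    qed
  qed
qed

lemma card_theta_closure:
  fixes X :: "'a topology"
  assumes \<kappa>: "Cinfinite \<kappa>" "kappa_theta_bound X n \<kappa>" and n: "n \<ge> 1"
    and S: "S_space X (2 * n)" and A: "|A| \<le>o \<kappa>"
  shows "|theta_closure X n A| \<le>o ctwo ^c \<kappa>"
proof -
  obtain \<V> where \<V>: "\<And>x V. x \<in> topspace X \<Longrightarrow> V \<in> \<V> x \<Longrightarrow> is_closed_hull X n {x} V"
      "\<And>x. x \<in> topspace X \<Longrightarrow> |\<V> x| \<le>o \<kappa>"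
      "\<And>x W. x \<in> topspace X \<Longrightarrow> is_closed_hull X n {x} W \<Longrightarrow> \<exists>V\<in>\<V> x. V \<subseteq> W"
    using \<kappa>(2) unfolding kappa_theta_bound_def by metis
  define trace where "trace x = (\<lambda>V. V \<inter> A) ` \<V> x" for x
  \<comment> \<open>If \<open>x\<close> and \<open>y\<close> had the same traces, a hull of \<open>x\<close> inside \<open>P\<close> would meet \<open>A\<close> in the same set
    as some hull of \<open>y\<close>; a smaller hull of \<open>y\<close> inside \<open>Q\<close> would then meet \<open>A\<close> only within \<open>P \<inter> Q = {}\<close>.\<close>
  have "inj_on trace (theta_closure X n A)"
  proof (rule inj_onI, rule ccontr)
    fix x y assume *: "x \<in> theta_closure X n A" "y \<in> theta_closure X n A" "trace x = trace y" "x \<noteq> y"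
    then have top: "x \<in> topspace X" "y \<in> topspace X"
      using theta_closure_subset_topspace[of X n A] by blast+
    obtain P Q where P: "is_closed_hull X n {x} P" and Q: "is_closed_hull X n {y} Q" and "P \<inter> Q = {}"
      using S_space_disjoint_closed_hulls[OF S n top *(4)] by blast
    obtain V where V: "V \<in> \<V> x" "V \<subseteq> P"
      using \<V>(3)[OF top(1) P] by blast
    then have "V \<inter> A \<in> trace y"
      using *(3) unfolding trace_def by blast
    then obtain V' where V': "V' \<in> \<V> y" "V \<inter> A = V' \<inter> A"
      unfolding trace_def by blast
    obtain W where W: "is_closed_hull X n {y} W" "W \<subseteq> V' \<inter> Q"
      using is_closed_hull_Int[OF \<V>(1)[OF top(2) V'(1)] Q] by blast
    then have "W \<inter> A \<noteq> {}"
      using *(2) unfolding theta_closure_iff_closed_hulls[OF n] by blast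
    then show False
      using W(2) V(2) V'(2) \<open>P \<inter> Q = {}\<close> by blast
  qed
  moreover have "trace ` theta_closure X n A \<subseteq> {\<B>. \<B> \<subseteq> Pow A \<and> |\<B>| \<le>o \<kappa>}"
    using \<V>(2) theta_closure_subset_topspace[of X n A] card_of_image ordLeq_transitive
    unfolding trace_def by blast
  ultimately have "|theta_closure X n A| \<le>o |{\<B>. \<B> \<subseteq> Pow A \<and> |\<B>| \<le>o \<kappa>}|"
    using card_of_ordLeq by blast
  also have "|{\<B>. \<B> \<subseteq> Pow A \<and> |\<B>| \<le>o \<kappa>}| \<le>o ctwo ^c \<kappa>"
    by (intro card_small_subsets card_Pow_le_ctwo_cexp \<kappa>(1) A)
  finally show ?thesis .
qed

section \<open>Bounding the space\<close>

lemma card_topspace_le_infinite: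
  fixes X :: "'a topology" and \<kappa> :: "'k rel"
  assumes \<kappa>: "Cinfinite \<kappa>" and sL: "sL_theta_bound X n \<kappa>" and kappa: "kappa_theta_bound X n \<kappa>"
    and n: "n \<ge> 1" and S: "S_space X (2 * n)"
  shows "|topspace X| \<le>o ctwo ^c \<kappa>"
proof -
  obtain \<V> where \<V>: "\<And>x V. x \<in> topspace X \<Longrightarrow> V \<in> \<V> x \<Longrightarrow> is_closed_hull X n {x} V"
      "\<And>x. x \<in> topspace X \<Longrightarrow> |\<V> x| \<le>o \<kappa>"
      "\<And>x W. x \<in> topspace X \<Longrightarrow> is_closed_hull X n {x} W \<Longrightarrow> \<exists>V\<in>\<V> x. V \<subseteq> W"
    using kappa unfolding kappa_theta_bound_def by metis
  \<comment> \<open>The family \<open>\<V> x\<close> consists of closed hulls; \<open>h x V\<close> is an open hull whose closure is \<open>V\<close>.\<close>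
  define h where "h x V = (SOME H. is_hull X n {x} H \<and> V = X closure_of H)" for x V
  have h: "is_hull X n {x} (h x V) \<and> V = X closure_of h x V" if "x \<in> topspace X" "V \<in> \<V> x" for x V
    unfolding h_def using \<V>(1)[OF that] unfolding is_closed_hull_def by (rule someI_ex)
  define hulls where "hulls B = (\<Union>b\<in>B \<inter> topspace X. h b ` \<V> b)" for B
  define pt where "pt \<G> = (SOME x. x \<in> topspace X - X closure_of \<Union>\<G>)" for \<G>
  define \<Phi> where "\<Phi> B = theta_closure X n B \<union>
      pt ` {\<G> \<in> Pow (hulls B). \<not> topspace X \<subseteq> X closure_of \<Union>\<G>}" for B
  have pt: "pt \<G> \<in> topspace X - X closure_of \<Union>\<G>" if "\<not> topspace X \<subseteq> X closure_of \<Union>\<G>" for \<G>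
    unfolding pt_def by (rule someI_ex) (use that in blast)
  have "|\<Phi> B| \<le>o ctwo ^c \<kappa>" if B: "|B| \<le>o \<kappa>" for B
  proof -
    have "|B \<inter> topspace X| \<le>o \<kappa>"
      using B card_of_mono1[of "B \<inter> topspace X" B] ordLeq_transitive by blast
    moreover have "|h b ` \<V> b| \<le>o \<kappa>" if "b \<in> topspace X" for b
      using \<V>(2)[OF that] card_of_image ordLeq_transitive by blast
    ultimately have "|hulls B| \<le>o \<kappa>"
      unfolding hulls_def by (intro UNION_Cinfinite_bound \<kappa>) auto
    then have "|Pow (hulls B)| \<le>o ctwo ^c \<kappa>"
      by (rule card_Pow_le_ctwo_cexp[OF \<kappa>])
    then have "|pt ` {\<G> \<in> Pow (hulls B). \<not> topspace X \<subseteq> X closure_of \<Union>\<G>}| \<le>o ctwo ^c \<kappa>"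
      by (rule ordLeq_transitive[OF surj_imp_ordLeq, rotated]) blast
    then show ?thesis
      unfolding \<Phi>_def using card_theta_closure[OF \<kappa> kappa n S B]
      by (intro Un_Cinfinite_bound Cinfinite_ctwo_cexp \<kappa>)
  qed
  then obtain F where F: "|F| \<le>o ctwo ^c \<kappa>" "F \<subseteq> \<Union>(range \<Phi>)"
      "\<And>B. B \<subseteq> F \<Longrightarrow> |B| \<le>o \<kappa> \<Longrightarrow> \<Phi> B \<subseteq> F"
    using ex_small_closed_set[OF \<kappa>, of \<Phi>] by blast
  have "\<Phi> B \<subseteq> topspace X" for B
    unfolding \<Phi>_def using theta_closure_subset_topspace[of X n B] pt by blast
  then have F_top: "F \<subseteq> topspace X"
    using F(2) by blast
  have F_theta: "theta_closure X n F \<subseteq> F"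
  proof
    fix x assume "x \<in> theta_closure X n F"
    then obtain B where "B \<subseteq> F" "|B| \<le>o \<kappa>" "x \<in> theta_closure X n B"
      using theta_closure_small_subset[OF kappa n] by blast
    then show "x \<in> F"
      using F(3)[of B] unfolding \<Phi>_def by blast
  qed
  have "topspace X \<subseteq> F"
  proof
    fix p assume p: "p \<in> topspace X"
    show "p \<in> F"
    proof (rule ccontr)
      assume "p \<notin> F"
      then have "p \<notin> theta_closure X n F"
        using F_theta by blast
      then obtain H where H: "is_hull X n {p} H" "X closure_of H \<inter> F = {}"
        using p unfolding theta_closure_iff_closed_hulls[OF n] is_closed_hull_def by blast
      obtain G where G: "openin X G" "p \<in> G"
          "is_hull X n (topspace X - X closure_of H) (topspace X - X closure_of G)"
        using is_hull_complement[OF H(1) n] by blast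
      \<comment> \<open>The single neighbourhood \<open>G\<close> of \<open>p\<close> serves all points of \<open>F\<close> at once, so the union of the
        selected hulls stays away from \<open>p\<close>.\<close>
      have "\<exists>V\<in>\<V> a. V \<inter> G = {}" if a: "a \<in> F" for a
      proof -
        have "is_hull X n {a} (topspace X - X closure_of G)"
          using G(3) a F_top H(2) unfolding is_hull_def by blast
        then obtain V where "V \<in> \<V> a" "V \<subseteq> X closure_of (topspace X - X closure_of G)"
          using \<V>(3)[of a] a F_top unfolding is_closed_hull_def by blast
        then show ?thesis
          using closure_of_exterior_disjoint[OF G(1)] by blast
      qed
      then obtain v where v: "\<And>a. a \<in> F \<Longrightarrow> v a \<in> \<V> a" "\<And>a. a \<in> F \<Longrightarrow> v a \<inter> G = {}"
        by metis
      define O' where "O' a = h a (v a)" for a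
      have O': "openin X (O' a)" "a \<in> O' a" "O' a \<inter> G = {}" "O' a \<in> h a ` \<V> a" if a: "a \<in> F" for a
      proof -
        have "is_hull X n {a} (O' a)" and v_a: "v a = X closure_of O' a"
          using h[of a "v a"] v(1)[OF a] a F_top unfolding O'_def by blast+
        then show op: "openin X (O' a)" and "a \<in> O' a"
          using is_hullE[OF _ n, of X "{a}" "O' a"] by auto
        show "O' a \<inter> G = {}"
          using v(2)[OF a] v_a closure_of_subset[OF openin_subset[OF op]] by blast
        show "O' a \<in> h a ` \<V> a"
          using v(1)[OF a] unfolding O'_def by blast
      qed
      have "theta_closure X n F \<subseteq> \<Union>(O' ` F)"
        using F_theta O'(2) by blast
      moreover have "\<forall>U\<in>O' ` F. openin X U"
        using O'(1) by simp
      ultimately have "\<exists>\<W>\<subseteq>O' ` F. |\<W>| \<le>o \<kappa> \<and> F \<subseteq> X closure_of \<Union>\<W>"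
        using F_top by (intro sL[unfolded sL_theta_bound_def, rule_format] conjI)
      then obtain \<W> where \<W>: "\<W> \<subseteq> O' ` F" "|\<W>| \<le>o \<kappa>" "F \<subseteq> X closure_of \<Union>\<W>"
        by blast
      define B where "B = inv_into F O' ` \<W>"
      have B: "B \<subseteq> F" "|B| \<le>o \<kappa>" "\<W> = O' ` B"
      proof -
        show "B \<subseteq> F" "\<W> = O' ` B"
          unfolding B_def using \<W>(1)
          by (auto simp: image_image f_inv_into_f subset_eq inv_into_into cong: image_cong)
        show "|B| \<le>o \<kappa>"
          unfolding B_def using \<W>(2) card_of_image ordLeq_transitive by blast
      qed
      have "\<W> \<subseteq> hulls B"
      proof
        fix U assume "U \<in> \<W>"
        then obtain b where "b \<in> B" "U = O' b"
          using B(3) by blast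
        then have "b \<in> B \<inter> topspace X" "U \<in> h b ` \<V> b"
          using O'(4)[of b] B(1) F_top by auto
        then show "U \<in> hulls B"
          unfolding hulls_def by (rule UN_I)
      qed
      moreover have "G \<inter> \<Union>\<W> = {}"
        using \<W>(1) O'(3) by blast
      then have "p \<notin> X closure_of \<Union>\<W>"
        using G(2) openin_Int_closure_of_eq_empty[OF G(1)] by blast
      then have nd: "\<not> topspace X \<subseteq> X closure_of \<Union>\<W>"
        using p by blast
      ultimately have "pt \<W> \<in> \<Phi> B"
        unfolding \<Phi>_def by blast
      then have "pt \<W> \<in> F"
        using F(3)[OF B(1,2)] by blast
      then show False
        using pt[OF nd] \<W>(3) by blast
    qed
  qed
  then show ?thesis
    using F(1) by (rule ordLeq_transitive[OF card_of_mono1])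
qed

text \<open>The intersection of the finitely many chosen closed hulls of a point contains a closed hull of
  it, and by separation this one reduces to the point; hence the space is discrete.\<close>

lemma card_topspace_le_finite:
  fixes X :: "'a topology" and \<sigma> :: "'s rel" and \<kappa> :: "'k rel"
  assumes sL: "sL_theta_bound X n \<sigma>" and kappa: "kappa_theta_bound X n \<kappa>"
    and \<kappa>: "Card_order \<kappa>" "finite (Field \<kappa>)"
    and n: "n \<ge> 1" and S: "S_space X (2 * n)"
  shows "|topspace X| \<le>o \<sigma>"
proof -
  have open_sing: "openin X {x}" if x: "x \<in> topspace X" for x
  proof -
    obtain \<V> where \<V>: "\<And>V. V\<in>\<V> \<Longrightarrow> is_closed_hull X n {x} V" "|\<V>| \<le>o \<kappa>"
        "\<And>W. is_closed_hull X n {x} W \<Longrightarrow> \<exists>V\<in>\<V>. V \<subseteq> W"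
      using kappa x unfolding kappa_theta_bound_def by metis
    have "|\<V>| \<le>o |Field \<kappa>|"
      using \<V>(2) \<kappa>(1) ordLeq_ordIso_trans ordIso_symmetric card_of_Field_ordIso by blast
    then have "finite \<V>"
      using \<kappa>(2) card_of_ordLeq_finite by blast
    then obtain W where W: "is_closed_hull X n {x} W" "W \<subseteq> \<Inter>\<V>"
      using is_closed_hull_Inter \<V>(1) x by (metis empty_subsetI insert_subset)
    obtain H where H: "is_hull X n {x} H" "W = X closure_of H"
      using W(1) unfolding is_closed_hull_def by blast
    then have H': "openin X H" "{x} \<subseteq> H"
      using is_hullE[OF H(1) n] by auto
    have "W \<subseteq> {x}"
    proof
      fix y assume y: "y \<in> W"
      then have "y \<in> topspace X"
        using H(2) closure_of_subset_topspace by fast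
      show "y \<in> {x}"
      proof (rule ccontr)
        assume "y \<notin> {x}"
        then obtain P Q where "is_closed_hull X n {x} P" "is_closed_hull X n {y} Q" "P \<inter> Q = {}"
          using S_space_disjoint_closed_hulls[OF S n x \<open>y \<in> topspace X\<close>] by auto
        then show False
          using \<V>(3)[of P] W(2) y is_closed_hull_subset[OF _ n, of X "{y}" Q] by blast
      qed
    qed
    then have "H = {x}"
      using H' H(2) closure_of_subset[OF openin_subset[OF H'(1)]] by auto
    then show ?thesis
      using H'(1) by simp
  qed
  have "theta_closure X n (topspace X) \<subseteq> \<Union>((\<lambda>x. {x}) ` topspace X)"
    using theta_closure_subset_topspace[of X n "topspace X"] by auto
  then obtain \<W> where \<W>: "\<W> \<subseteq> (\<lambda>x. {x}) ` topspace X" "|\<W>| \<le>o \<sigma>" "topspace X \<subseteq> X closure_of \<Union>\<W>"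
    using sL open_sing unfolding sL_theta_bound_def by (metis (no_types, lifting) imageE order_refl)
  have "x \<in> \<Union>\<W>" if x: "x \<in> topspace X" for x
    using openin_Int_closure_of_eq_empty[OF open_sing[OF x], of "\<Union>\<W>"] \<W>(3) x by blast
  then have "topspace X \<subseteq> the_elem ` \<W>"
    using \<W>(1) by force
  then show ?thesis
    using \<W>(2) surj_imp_ordLeq ordLeq_transitive by blast
qed

theorem theorem3p6:
  fixes X :: "'a topology" and n :: nat
  assumes "n \<ge> 1"
    and "t1_space X"
    and "S_space X (2 * n)"
  shows "|topspace X| \<le>o ctwo ^c (sL_theta X n *c kappa_theta X n)"
proof (cases "topspace X = {}")
  case True
  then show ?thesis
    by (simp add: card_of_empty1 cexp_def card_of_Well_order)
next
  case False
  then obtain x where x: "x \<in> topspace X" by blast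
  let ?\<sigma> = "sL_theta X n" and ?\<kappa> = "kappa_theta X n"
  note \<sigma> = sL_theta[OF assms(1), of X] and \<kappa> = kappa_theta[of X n]
  have empty: "\<V> = {}" if "Card_order r" "\<not> Cnotzero r" "|\<V>| \<le>o r"
    for r :: "'a set rel" and \<V> :: "'a set set"
  proof -
    have "r =o (czero :: 'a set rel)"
      using that(1,2) by blast
    then show ?thesis
      using that(3) ordLeq_ordIso_trans card_of_empty3 unfolding czero_def by blast
  qed
  \<comment> \<open>Neither factor vanishes, since the families attached to the point \<open>x\<close> cannot be empty; so each
    factor is bounded by the product.\<close>
  have "Cnotzero ?\<kappa>"
  proof (rule ccontr)
    assume "\<not> Cnotzero ?\<kappa>"
    then show False
      using \<kappa>(2) x empty[OF \<kappa>(1)] is_closed_hull_topspace[of "{x}" X n]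
      unfolding kappa_theta_bound_def by blast
  qed
  have "Cnotzero ?\<sigma>"
  proof (rule ccontr)
    assume *: "\<not> Cnotzero ?\<sigma>"
    have "theta_closure X n {x} \<subseteq> \<Union>{topspace X}"
      using theta_closure_subset_topspace[of X n "{x}"] by simp
    then obtain \<V> where \<V>: "|\<V>| \<le>o ?\<sigma>" "{x} \<subseteq> X closure_of \<Union>\<V>"
      using \<sigma>(2) x unfolding sL_theta_bound_def
      by (metis empty_subsetI insert_subset openin_topspace singletonD)
    then show False
      using empty[OF \<sigma>(1) * \<V>(1)] by simp
  qed
  have \<sigma>_le: "?\<sigma> \<le>o ?\<sigma> *c ?\<kappa>"
    using ordLeq_cprod2[OF \<open>Cnotzero ?\<kappa>\<close> \<sigma>(1)] cprod_com ordLeq_ordIso_trans by blast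
  have \<kappa>_le: "?\<kappa> \<le>o ?\<sigma> *c ?\<kappa>"
    by (rule ordLeq_cprod2[OF \<open>Cnotzero ?\<sigma>\<close> \<kappa>(1)])
  show ?thesis
  proof (cases "cinfinite (?\<sigma> *c ?\<kappa>)")
    case True
    then show ?thesis
      using assms sL_theta_bound_mono[OF \<sigma>(2) \<sigma>_le] kappa_theta_bound_mono[OF \<kappa>(2) \<kappa>_le]
      by (intro card_topspace_le_infinite) (auto simp: Card_order_cprod)
  next
    case False
    then have "finite (Field ?\<kappa>)"
      using cinfinite_mono[OF \<kappa>_le] by (auto simp: cinfinite_def)
    then have "|topspace X| \<le>o ?\<sigma>"
      using card_topspace_le_finite[OF \<sigma>(2) \<kappa>(2) \<kappa>(1)] assms by blast
    then show ?thesis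
      by (rule ordLeq_transitive[OF ordLeq_transitive[OF _ \<sigma>_le] ordLeq_ctwo_cexp[OF Card_order_cprod]])
  qed
qed

end
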